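(* There is a constant $b_0 > 0$ such that for every integer $N \geq 1$, if $\sigma_1,\sigma_2,\sigma_3,\sigma_4$ are independent uniformly random elements of the symmetric group $\mathcal{S}_N$, then $$\mathbb{P}\left( \bigcap_{j=1}^4 \mathcal{I}(\sigma_j) = \emptyset \right) \geq b_0 .$$
   Context: $[N] = \{1,\dots,N\}$ and $\mathcal{S}_N$ is the group of permutations of $[N]$. For $\sigma \in \mathcal{S}_N$, $\mathcal{I}(\sigma)$ is the set of sizes of nontrivial invariant sets of $\sigma$: $$\mathcal{I}(\sigma) := \{ |I| : I \text{ is a nonempty proper subset of } [N] \text{ and } \sigma(I) = I \}.$$ *)

theory Defs
  imports "HOL-Probability.Probability" "HOL-Probability.Product_PMF"
    "HOL-Combinatorics.Permutations"
begin

text \<open>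
  Here \<open>\<sigma>\<close> is meant to satisfy \<open>\<sigma> permutes {1..N}\<close>. The size \<open>N\<close> has to be an
  explicit argument, because it cannot be recovered from the function \<open>\<sigma>\<close>.
\<close>

definition invariant_sizes :: "nat \<Rightarrow> (nat \<Rightarrow> nat) \<Rightarrow> nat set" where
  "invariant_sizes N \<sigma> = {card I | I. I \<noteq> {} \<and> I \<subset> {1..N} \<and> \<sigma> ` I = I}"

definition uniform_perm :: "nat \<Rightarrow> (nat \<Rightarrow> nat) pmf" where
  "uniform_perm N = pmf_of_set {\<sigma>. \<sigma> permutes {1..N}}"

text \<open>
  The joint law of \<open>k\<close> independent uniformly random permutations
  \<open>\<sigma> 1, \<dots>, \<sigma> k\<close> of \<open>{1..N}\<close>. The argument \<open>id\<close> is only the value that the family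
  \<open>\<sigma>\<close> takes at indices outside \<open>{1..k}\<close>.
\<close>

definition indep_uniform_perms :: "nat \<Rightarrow> nat \<Rightarrow> (nat \<Rightarrow> nat \<Rightarrow> nat) pmf" where
  "indep_uniform_perms k N = Pi_pmf {1..k} id (\<lambda>_. uniform_perm N)"

end

theory Submission
  imports Defs "HOL-Combinatorics.Orbits"
begin

text \<open>
  The expected number of invariant sets of size \<open>k\<close> is \<open>1\<close>, but it is dominated by rare permutations:
  an invariant \<open>k\<close>-set splits the permutation into two uniform ones, which together have about
  \<open>2 ln k\<close> cycles of length at most \<open>k\<close>, while a typical permutation has about \<open>ln k\<close>. If the number of
  cycles shorter than \<open>2 ^ i\<close> is required to be at most \<open>11 i / 15\<close> for all \<open>i\<close>, the probability
  that \<open>k\<close> is an invariant size drops to \<open>O(k powr (- 4 / 15))\<close>, and the fourth power of this is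
  summable. The requirement is mild because \<open>11 / 15 > ln 2\<close>. To make the sum over \<open>k\<close> small
  relative to the probability of the requirement, cycles shorter than \<open>2 ^ L\<close> are forbidden for a
  large constant \<open>L\<close>; each of the four permutations pays a factor \<open>2 ^ L\<close> on both sides of the
  comparison.

  All probabilities are read off from the mean \<open>a n\<close> of a multiplicative weight
  \<open>\<Prod>C. w (card C)\<close> over the cycles \<open>C\<close>. It satisfies \<open>n a n = (\<Sum>j=1..n. w j * a (n - j))\<close>,
  hence is at most a constant times \<open>exp (\<Sum>j=1..n. (w j - 1) / j)\<close>.
\<close>

section \<open>Multiplicative weights on cycles\<close>

text \<open>By injectivity, a permutation that preserves \<open>B\<close> also preserves
  \<open>A - B\<close>. It is therefore the product of its two restrictions, each extended by the
  identity.\<close>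

lemma bij_betw_comp_permutes_invariant:
  assumes "B \<subseteq> A"
  shows "bij_betw (\<lambda>(p, q). p \<circ> q) ({p. p permutes B} \<times> {q. q permutes (A - B)})
    {s. s permutes A \<and> s ` B = B}"
proof (rule bij_betw_byWitness[where f' = "\<lambda>s. (restrict_id s B, restrict_id s (A - B))"])
  have "restrict_id (p \<circ> q) B = p \<and> restrict_id (p \<circ> q) (A - B) = q"
    if p: "p permutes B" and q: "q permutes (A - B)" for p q
  proof -
    have "restrict_id (p \<circ> q) B x = p x" for x
      using permutes_not_in[OF p, of x] permutes_not_in[OF q, of x]
      by (cases "x \<in> B") auto
    moreover have "restrict_id (p \<circ> q) (A - B) x = q x" for x
      using permutes_not_in[OF p, of "q x"] permutes_not_in[OF q, of x] permutes_in_image[OF q, of x]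
      by (cases "x \<in> A - B") auto
    ultimately show ?thesis by blast
  qed
  then show "\<forall>a\<in>{p. p permutes B} \<times> {q. q permutes (A - B)}.
      (restrict_id (case a of (p, q) \<Rightarrow> p \<circ> q) B,
       restrict_id (case a of (p, q) \<Rightarrow> p \<circ> q) (A - B)) = a"
    by auto
  have image_Diff: "s ` (A - B) = A - B" if "s permutes A" "s ` B = B" for s
    using that by (simp add: image_set_diff permutes_inj permutes_image)
  show "\<forall>s\<in>{s. s permutes A \<and> s ` B = B}.
      (case (restrict_id s B, restrict_id s (A - B)) of (p, q) \<Rightarrow> p \<circ> q) = s"
  proof clarsimp
    fix s assume s: "s permutes A" and sB: "s ` B = B"
    have "(restrict_id s B \<circ> restrict_id s (A - B)) x = s x" for x
    proof (cases "x \<in> A - B")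
      case True
      then have "s x \<notin> B" using image_Diff[OF s sB] by blast
      then show ?thesis using True by simp
    next
      case False
      then show ?thesis using sB permutes_not_in[OF s, of x] by (cases "x \<in> B") auto
    qed
    then show "restrict_id s B \<circ> restrict_id s (A - B) = s" by auto
  qed
  show "(\<lambda>(p, q). p \<circ> q) ` ({p. p permutes B} \<times> {q. q permutes (A - B)})
      \<subseteq> {s. s permutes A \<and> s ` B = B}"
  proof clarsimp
    fix p q assume p: "p permutes B" and q: "q permutes (A - B)"
    have "(p \<circ> q) permutes A"
      using permutes_subset[OF p assms] permutes_subset[OF q, of A] by (intro permutes_compose) auto
    moreover have "q ` B = B" using permutes_not_in[OF q] by force
    ultimately show "(p \<circ> q) permutes A \<and> (\<lambda>x. p (q x)) ` B = B"
      using permutes_image[OF p] by (metis image_comp image_image)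
  qed
  show "(\<lambda>s. (restrict_id s B, restrict_id s (A - B))) ` {s. s permutes A \<and> s ` B = B}
      \<subseteq> {p. p permutes B} \<times> {q. q permutes (A - B)}"
    using image_Diff by (auto intro!: permutes_restrict_id simp: bij_betw_def dest: permutes_inj_on)
qed

text \<open>The product runs over the set of orbits rather than over points, so each cycle
  contributes once; a fixed point in \<open>A\<close> contributes \<open>w 1\<close>.\<close>

definition cycle_weight :: "(nat \<Rightarrow> real) \<Rightarrow> 'a set \<Rightarrow> ('a \<Rightarrow> 'a) \<Rightarrow> real" where
  "cycle_weight w A \<sigma> = (\<Prod>C\<in>orbit \<sigma> ` A. w (card C))"

definition total_weight :: "(nat \<Rightarrow> real) \<Rightarrow> 'a set \<Rightarrow> real" where
  "total_weight w A = (\<Sum>\<sigma> | \<sigma> permutes A. cycle_weight w A \<sigma>)"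

lemma orbit_comp_left:
  assumes "p permutes B" "q permutes (A - B)" "x \<in> B"
  shows "orbit (p \<circ> q) x = orbit p x"
proof (rule orbit_cong0[symmetric, where A = B])
  show "p \<in> B \<rightarrow> B" using permutes_in_image[OF assms(1)] by auto
qed (use assms permutes_not_in[OF assms(2)] in auto)

lemma orbit_comp_right:
  assumes "p permutes B" "q permutes (A - B)" "x \<in> A - B"
  shows "orbit (p \<circ> q) x = orbit q x"
proof (rule orbit_cong0[symmetric, where A = "A - B"])
  show "q \<in> (A - B) \<rightarrow> (A - B)" using permutes_in_image[OF assms(2)] by auto
  show "q y = (p \<circ> q) y" if "y \<in> A - B" for y
    using that permutes_in_image[OF assms(2), of y] permutes_not_in[OF assms(1), of "q y"] by auto
qed (use assms in auto)

lemma cycle_weight_comp: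
  assumes "finite A" "B \<subseteq> A" and p: "p permutes B" and q: "q permutes (A - B)"
  shows "cycle_weight w A (p \<circ> q) = cycle_weight w B p * cycle_weight w (A - B) q"
proof -
  have "orbit (p \<circ> q) ` A = orbit (p \<circ> q) ` B \<union> orbit (p \<circ> q) ` (A - B)"
    using assms(2) by auto
  also have "\<dots> = orbit p ` B \<union> orbit q ` (A - B)"
    using orbit_comp_left[OF p q] orbit_comp_right[OF p q] by (metis image_cong)
  finally have "orbit (p \<circ> q) ` A = orbit p ` B \<union> orbit q ` (A - B)" .
  moreover have "orbit p ` B \<inter> orbit q ` (A - B) = {}"
    using permutes_orbit_subset[OF p] permutes_orbit_subset[OF q] orbit_nonempty[of p] by blast
  ultimately show ?thesis
    unfolding cycle_weight_def using assms(1) finite_subset[OF assms(2,1)]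
    by (simp add: prod.union_disjoint)
qed

lemma cycle_weight_cyclic:
  assumes "finite A" "p permutes A" "x \<in> A" "orbit p x = A"
  shows "cycle_weight w A p = w (card A)"
proof -
  have "orbit p y = A" if "y \<in> A" for y
    using orbit_cyclic_eq3[OF cyclic_on_orbit[OF assms(2,1), of x]] that assms(4) by auto
  then have "orbit p ` A = {A}" using assms(3) by auto
  then show ?thesis by (simp add: cycle_weight_def)
qed

text \<open>Every cycle lies inside \<open>B\<close> or inside \<open>A - B\<close>, so the weight
  is multiplicative along the splitting. This is what controls the existence of an invariant
  set.\<close>

lemma sum_invariant_cycle_weight:
  assumes "finite A" "B \<subseteq> A"
  shows "(\<Sum>\<sigma> | \<sigma> permutes A \<and> \<sigma> ` B = B. cycle_weight w A \<sigma>)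
    = total_weight w B * total_weight w (A - B)"
proof -
  have "(\<Sum>\<sigma> | \<sigma> permutes A \<and> \<sigma> ` B = B. cycle_weight w A \<sigma>)
    = (\<Sum>(p, q)\<in>{p. p permutes B} \<times> {q. q permutes (A - B)}. cycle_weight w A (p \<circ> q))"
    using sum.reindex_bij_betw[OF bij_betw_comp_permutes_invariant[OF assms(2)],
        of "cycle_weight w A"] by (simp add: case_prod_unfold)
  also have "\<dots> = (\<Sum>(p, q)\<in>{p. p permutes B} \<times> {q. q permutes (A - B)}.
      cycle_weight w B p * cycle_weight w (A - B) q)"
    by (intro sum.cong refl) (auto simp: cycle_weight_comp[OF assms])
  also have "\<dots> = total_weight w B * total_weight w (A - B)"
    by (simp add: total_weight_def sum_product sum.cartesian_product)
  finally show ?thesis .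
qed

text \<open>If \<open>B\<close> is the cycle through \<open>x\<close>, the permutation is a single
  cycle on \<open>B\<close> together with an arbitrary permutation of \<open>A - B\<close>. The
  number of such cycles stays unevaluated here, because it is computed from the resulting recurrence
  with weight 1.\<close>

lemma sum_orbit_cycle_weight:
  assumes "finite A" "B \<subseteq> A" "x \<in> B"
  shows "(\<Sum>\<sigma> | \<sigma> permutes A \<and> orbit \<sigma> x = B. cycle_weight w A \<sigma>)
    = real (card {p. p permutes B \<and> orbit p x = B}) * w (card B) * total_weight w (A - B)"
proof -
  have fin: "finite B" using assms finite_subset by blast
  let ?P = "{p. p permutes B}" and ?Q = "{q. q permutes (A - B)}"
  have inv: "\<sigma> ` B = B" if "\<sigma> permutes A" "orbit \<sigma> x = B" for \<sigma>
  proof (rule endo_inj_surj[OF fin])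
    show "\<sigma> ` B \<subseteq> B" using that by (auto intro: orbit.step)
    show "inj_on \<sigma> B" by (rule permutes_inj_on[OF that(1)])
  qed
  have "(\<Sum>\<sigma> | \<sigma> permutes A \<and> orbit \<sigma> x = B. cycle_weight w A \<sigma>)
    = (\<Sum>\<sigma> | \<sigma> permutes A \<and> \<sigma> ` B = B. of_bool (orbit \<sigma> x = B) * cycle_weight w A \<sigma>)"
    by (rule sum.mono_neutral_cong_left) (use assms(1) inv in \<open>auto simp: finite_permutations\<close>)
  also have "\<dots> = (\<Sum>(p, q)\<in>?P \<times> ?Q. of_bool (orbit (p \<circ> q) x = B) * cycle_weight w A (p \<circ> q))"
    using sum.reindex_bij_betw[OF bij_betw_comp_permutes_invariant[OF assms(2)],
        of "\<lambda>\<sigma>. of_bool (orbit \<sigma> x = B) * cycle_weight w A \<sigma>"] by (simp add: case_prod_unfold)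
  also have "\<dots> = (\<Sum>(p, q)\<in>?P \<times> ?Q. (of_bool (orbit p x = B) * w (card B)) * cycle_weight w (A - B) q)"
    by (intro sum.cong refl)
      (auto simp: cycle_weight_comp[OF assms(1,2)] orbit_comp_left[OF _ _ assms(3)]
        cycle_weight_cyclic[OF fin _ assms(3)])
  also have "\<dots> = (\<Sum>p\<in>?P. of_bool (orbit p x = B) * w (card B)) * total_weight w (A - B)"
    by (simp add: total_weight_def sum_product sum.cartesian_product)
  also have "(\<Sum>p\<in>?P. of_bool (orbit p x = B) * w (card B))
      = real (card {p. p permutes B \<and> orbit p x = B}) * w (card B)"
    using finite_permutations[OF fin] by (simp add: sum_distrib_right[symmetric] Int_def)
  finally show ?thesis by simp
qed

text \<open>The permutations are grouped by the cycle containing \<open>x\<close>.\<close>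

lemma total_weight_recurrence:
  assumes "finite A" "x \<in> A"
  shows "total_weight w A = (\<Sum>B | B \<subseteq> A \<and> x \<in> B.
    real (card {p. p permutes B \<and> orbit p x = B}) * w (card B) * total_weight w (A - B))"
proof -
  let ?Bs = "{B. B \<subseteq> A \<and> x \<in> B}"
  have "total_weight w A = (\<Sum>B\<in>?Bs. \<Sum>\<sigma> | \<sigma> \<in> {\<sigma>. \<sigma> permutes A} \<and> orbit \<sigma> x = B. cycle_weight w A \<sigma>)"
    unfolding total_weight_def
  proof (rule sum.group[symmetric])
    show "(\<lambda>\<sigma>. orbit \<sigma> x) ` {\<sigma>. \<sigma> permutes A} \<subseteq> ?Bs"
      using permutes_orbit_subset[OF _ assms(2)] assms(1)
      by (auto intro!: permutation_self_in_orbit simp: permutation_permutes)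
  qed (use assms in \<open>auto simp: finite_permutations\<close>)
  also have "\<dots> = (\<Sum>B\<in>?Bs.
    real (card {p. p permutes B \<and> orbit p x = B}) * w (card B) * total_weight w (A - B))"
    by (intro sum.cong refl) (use assms in \<open>simp add: sum_orbit_cycle_weight\<close>)
  finally show ?thesis .
qed

lemma sum_subsets_containing:
  fixes f :: "nat \<Rightarrow> real"
  assumes "finite A" "x \<in> A"
  shows "(\<Sum>B | B \<subseteq> A \<and> x \<in> B. f (card B)) = (\<Sum>j=1..card A. of_nat (card A - 1 choose (j - 1)) * f j)"
proof -
  let ?A = "A - {x}"
  have fin: "finite ?A" using assms by auto
  have Suc_card: "Suc (card (B - {x})) = card B" if "B \<subseteq> A" "x \<in> B" for B
    using that finite_subset[OF that(1) assms(1)] by (intro card_Suc_Diff1)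
  have "(\<Sum>B | B \<subseteq> A \<and> x \<in> B. f (card B)) = (\<Sum>B\<in>Pow ?A. f (Suc (card B)))"
    by (rule sum.reindex_bij_witness[where i = "insert x" and j = "\<lambda>B. B - {x}"])
      (use assms Suc_card in \<open>auto simp del: card_Diff_insert card_Diff_singleton\<close>)
  also have "\<dots> = (\<Sum>j=0..card ?A. \<Sum>B | B \<in> Pow ?A \<and> card B = j. f (Suc (card B)))"
    by (rule sum.group[symmetric]) (use fin in \<open>auto simp: card_mono\<close>)
  also have "\<dots> = (\<Sum>j=0..card ?A. of_nat (card ?A choose j) * f (Suc j))"
    by (intro sum.cong refl) (simp add: n_subsets[OF fin])
  also have "\<dots> = (\<Sum>j=1..card A. of_nat (card A - 1 choose (j - 1)) * f j)"
    by (rule sum.reindex_bij_witness[where i = "\<lambda>j. j - 1" and j = Suc])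
      (use assms card_Suc_Diff1[OF assms] in auto)
  finally show ?thesis .
qed

lemma total_weight_one: "total_weight (\<lambda>_. 1) A = card {\<sigma>. \<sigma> permutes A}"
  by (simp add: total_weight_def cycle_weight_def)

text \<open>The factors count the sets for a \<open>j\<close>-cycle through a given point, the
  cycles on such a set, and the permutations of the rest. The product is independent of
  \<open>j\<close>: all lengths of that cycle are equally likely, which removes binomials from the
  recurrence.\<close>

lemma choose_mult_facts:
  assumes "j \<in> {1..n}"
  shows "of_nat (n - 1 choose (j - 1)) * (fact (j - 1) * fact (n - j)) = (fact (n - 1) :: real)"
proof -
  have "n - 1 - (j - 1) = n - j" using assms by auto
  then show ?thesis using assms binomial_fact[of "j - 1" "n - 1", where 'a = real]
    by (simp add: diff_le_mono)
qed

text \<open>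
  With \<open>w = 1\<close> the recurrence says \<open>n! = (\<Sum>j=1..n. (n - 1 choose (j - 1)) * c j * (n - j)!)\<close> for the
  number \<open>c j\<close> of \<open>j\<close>-cycles, so \<open>c n = (n - 1)!\<close> once this is known for smaller sets.
\<close>

lemma card_cyclic_permutations:
  assumes "finite A" "x \<in> A"
  shows "card {p. p permutes A \<and> orbit p x = A} = fact (card A - 1)"
  using assms
proof (induction A rule: finite_psubset_induct)
  case (psubset A)
  define n where "n = card A"
  have n: "n > 0" using psubset by (auto simp: n_def card_gt_0_iff)
  let ?c = "\<lambda>B. card {p. p permutes B \<and> orbit p x = B}"
  have tot: "total_weight (\<lambda>_. 1) (A - B) = fact (n - card B)" if "B \<subseteq> A" for B
    using that psubset.hyps finite_subset[OF that]
    by (simp add: total_weight_one card_permutations[OF refl] card_Diff_subset n_def)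
  have "fact n = (\<Sum>B | B \<subseteq> A \<and> x \<in> B. real (?c B) * total_weight (\<lambda>_. 1) (A - B))"
    using total_weight_recurrence[OF psubset.hyps psubset.prems, of "\<lambda>_. 1"]
    by (simp add: total_weight_one card_permutations[OF refl psubset.hyps] n_def)
  also have "\<dots> = (\<Sum>B\<in>insert A {B. B \<subset> A \<and> x \<in> B}. real (?c B) * total_weight (\<lambda>_. 1) (A - B))"
    using psubset.prems by (intro sum.cong refl) auto
  also have "\<dots> = ?c A + (\<Sum>B | B \<subset> A \<and> x \<in> B. real (?c B) * total_weight (\<lambda>_. 1) (A - B))"
    using psubset.hyps by (subst sum.insert) (auto simp: total_weight_one intro: finite_subset[of _ "Pow A"])
  also have "(\<Sum>B | B \<subset> A \<and> x \<in> B. real (?c B) * total_weight (\<lambda>_. 1) (A - B))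
     = (\<Sum>B | B \<subset> A \<and> x \<in> B. fact (card B - 1) * fact (n - card B))"
    using psubset.IH tot by (intro sum.cong refl) auto
  \<comment> \<open>The term \<open>B = A\<close>, with its predicted value
    \<open>fact (n - 1)\<close>, is added and subtracted. The completed sum is
    \<open>n * fact (n - 1) = fact n\<close>, which forces the prediction.\<close>
  also have "\<dots> = (\<Sum>B | B \<subseteq> A \<and> x \<in> B. fact (card B - 1) * fact (n - card B)) - fact (n - 1)"
  proof -
    have "{B. B \<subseteq> A \<and> x \<in> B} = insert A {B. B \<subset> A \<and> x \<in> B}" using psubset.prems by auto
    moreover have "finite {B. B \<subset> A \<and> x \<in> B}"
      using psubset.hyps by (auto intro: finite_subset[of _ "Pow A"])
    ultimately show ?thesis by (simp add: n_def)
  qed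
  also have "(\<Sum>B | B \<subseteq> A \<and> x \<in> B. fact (card B - 1) * fact (n - card B) :: real)
     = (\<Sum>j=1..n. of_nat (n - 1 choose (j - 1)) * (fact (j - 1) * fact (n - j)))"
    using sum_subsets_containing[OF psubset.hyps psubset.prems, of "\<lambda>j. fact (j - 1) * fact (n - j)"]
    by (simp add: n_def)
  also have "\<dots> = (\<Sum>j=1..n. fact (n - 1))"
  proof (intro sum.cong refl)
    fix j assume "j \<in> {1..n}"
    then show "of_nat (n - 1 choose (j - 1)) * (fact (j - 1) * fact (n - j)) = (fact (n - 1) :: real)"
      by (rule choose_mult_facts)
  qed
  also have "\<dots> = fact n" using n by (simp add: fact_reduce)
  finally have "real (?c A) = real (fact (n - 1))" by simp
  then show ?case unfolding n_def of_nat_eq_iff .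
qed

text \<open>These are the coefficients of the power series of
  \<open>exp (sum of w j / j * x ^ j)\<close>. \<open>total_weight_eq\<close> identifies them with
  the average of \<open>cycle_weight\<close> over all permutations of an
  \<open>n\<close>-set.\<close>

fun mean_weight :: "(nat \<Rightarrow> real) \<Rightarrow> nat \<Rightarrow> real" where
  "mean_weight w n = (if n = 0 then 1 else (\<Sum>j=1..n. w j * mean_weight w (n - j)) / n)"

declare mean_weight.simps [simp del]

lemma mean_weight_0 [simp]: "mean_weight w 0 = 1"
  by (simp add: mean_weight.simps)

lemma mean_weight_recurrence: "n * mean_weight w n = (\<Sum>j=1..n. w j * mean_weight w (n - j))"
  by (cases "n = 0") (simp_all add: mean_weight.simps[of w n])

lemma total_weight_eq:
  assumes "finite A"
  shows "total_weight w A = fact (card A) * mean_weight w (card A)"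
  using assms
proof (induction A rule: finite_psubset_induct)
  case (psubset A)
  show ?case
  proof (cases "A = {}")
    case True
    then show ?thesis by (simp add: total_weight_def cycle_weight_def)
  next
    case False
    then obtain x where x: "x \<in> A" by auto
    define n where "n = card A"
    have n: "n > 0" using psubset x by (auto simp: n_def card_gt_0_iff)
    have "total_weight w A = (\<Sum>B | B \<subseteq> A \<and> x \<in> B.
        fact (card B - 1) * w (card B) * (fact (n - card B) * mean_weight w (n - card B)))"
      unfolding total_weight_recurrence[OF psubset.hyps x]
    proof (intro sum.cong refl)
      fix B assume B: "B \<in> {B. B \<subseteq> A \<and> x \<in> B}"
      then have "finite B" "x \<in> B" using finite_subset psubset.hyps by auto
      moreover have "card (A - B) = n - card B" "A - B \<subset> A"
        using B \<open>finite B\<close> by (auto simp: n_def card_Diff_subset)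
      ultimately show "real (card {p. p permutes B \<and> orbit p x = B}) * w (card B) * total_weight w (A - B)
         = fact (card B - 1) * w (card B) * (fact (n - card B) * mean_weight w (n - card B))"
        using psubset.IH by (simp add: card_cyclic_permutations)
    qed
    also have "\<dots> = (\<Sum>j=1..n. of_nat (n - 1 choose (j - 1)) *
        (fact (j - 1) * w j * (fact (n - j) * mean_weight w (n - j))))"
      using sum_subsets_containing[OF psubset.hyps x,
          of "\<lambda>j. fact (j - 1) * w j * (fact (n - j) * mean_weight w (n - j))"]
      by (simp add: n_def)
    also have "\<dots> = (\<Sum>j=1..n. fact (n - 1) * (w j * mean_weight w (n - j)))"
    proof (intro sum.cong refl)
      fix j assume "j \<in> {1..n}"
      then have "of_nat (n - 1 choose (j - 1)) * (fact (j - 1) * fact (n - j)) = (fact (n - 1) :: real)"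
        by (rule choose_mult_facts)
      then show "of_nat (n - 1 choose (j - 1)) *
        (fact (j - 1) * w j * (fact (n - j) * mean_weight w (n - j))) =
        fact (n - 1) * (w j * mean_weight w (n - j))"
        by (metis (no_types, lifting) mult.assoc mult.left_commute)
    qed
    also have "\<dots> = fact (n - 1) * (n * mean_weight w n)"
      by (simp add: sum_distrib_left mean_weight_recurrence)
    also have "\<dots> = fact n * mean_weight w n" using n by (simp add: fact_reduce)
    finally show ?thesis by (simp add: n_def)
  qed
qed

section \<open>Bounds for the mean weight\<close>

lemma mean_weight_nonneg:
  assumes "\<And>j. w j \<ge> 0"
  shows "mean_weight w n \<ge> 0"
proof (induction n rule: less_induct)
  case (less n)
  then show ?case using assms by (subst mean_weight.simps) (auto intro!: sum_nonneg divide_nonneg_nonneg)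
qed

text \<open>
  The truncated generating functions \<open>F = (\<Sum>m\<le>n. a m * x ^ m)\<close> and \<open>G = (\<Sum>j=1..n. w j / j * x ^ j)\<close>
  satisfy \<open>F' \<le> G' * F\<close> on \<open>[0, 1]\<close>.
\<close>

lemma sum_mean_weight_le_exp:
  assumes w: "\<And>j. w j \<ge> 0"
  shows "(\<Sum>m\<le>n. mean_weight w m) \<le> exp (\<Sum>j=1..n. w j / j)"
proof -
  define F where "F x = (\<Sum>m\<le>n. mean_weight w m * x ^ m)" for x :: real
  define F' where "F' x = (\<Sum>m\<le>n. mean_weight w m * (m * x ^ (m - 1)))" for x :: real
  define G where "G x = (\<Sum>j=1..n. w j / j * x ^ j)" for x :: real
  define G' where "G' x = (\<Sum>j=1..n. w j / j * (j * x ^ (j - 1)))" for x :: real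
  have F: "(F has_field_derivative F' x) (at x)" for x
    unfolding F_def F'_def by (auto intro!: derivative_eq_intros sum.cong)
  have G: "(G has_field_derivative G' x) (at x)" for x
    unfolding G_def G'_def by (auto intro!: derivative_eq_intros sum.cong)
  have le: "F' x \<le> G' x * F x" if "x \<ge> 0" for x
  proof -
    let ?f = "\<lambda>(j, l). (w j * x ^ (j - 1)) * (mean_weight w l * x ^ l)"
    have "F' x = (\<Sum>m=1..n. mean_weight w m * (m * x ^ (m - 1)))"
      unfolding F'_def by (rule sum.mono_neutral_right) auto
    also have "\<dots> = (\<Sum>m=1..n. \<Sum>j=1..m. ?f (j, m - j))"
    proof (intro sum.cong refl)
      fix m assume "m \<in> {1..n}"
      have "mean_weight w m * (m * x ^ (m - 1)) = (m * mean_weight w m) * x ^ (m - 1)"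
        by simp
      also have "\<dots> = (\<Sum>j=1..m. ?f (j, m - j))"
        unfolding mean_weight_recurrence sum_distrib_right
      proof (intro sum.cong refl)
        fix j assume "j \<in> {1..m}"
        then have "m - 1 = (j - 1) + (m - j)" by auto
        then have "x ^ (m - 1) = x ^ (j - 1) * x ^ (m - j)" by (simp add: power_add)
        then show "w j * mean_weight w (m - j) * x ^ (m - 1) = ?f (j, m - j)" by simp
      qed
      finally show "mean_weight w m * (m * x ^ (m - 1)) = (\<Sum>j=1..m. ?f (j, m - j))" .
    qed
    also have "\<dots> = (\<Sum>(m, j)\<in>(SIGMA m:{1..n}. {1..m}). ?f (j, m - j))"
      by (rule sum.Sigma) auto
    also have "\<dots> = sum ?f ((\<lambda>(m, j). (j, m - j)) ` (SIGMA m:{1..n}. {1..m}))"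
      by (subst sum.reindex) (auto simp: inj_on_def case_prod_unfold)
    \<comment> \<open>Enlarging the triangle \<open>j + l <= n\<close> to a rectangle adds only
      nonnegative terms and makes the sum factor.\<close>
    also have "\<dots> \<le> sum ?f ({1..n} \<times> {..n})"
      by (rule sum_mono2) (use that w mean_weight_nonneg[of w] in auto)
    also have "\<dots> = (\<Sum>j=1..n. w j * x ^ (j - 1)) * F x"
      unfolding F_def by (simp add: sum_product sum.cartesian_product)
    also have "(\<Sum>j=1..n. w j * x ^ (j - 1)) = G' x"
      unfolding G'_def by (intro sum.cong) auto
    finally show ?thesis .
  qed
  \<comment> \<open>The derivative of \<open>F * exp (- G)\<close> is
    \<open>(F' - G' * F) * exp (- G)\<close>, which is nonpositive on \<open>[0, 1]\<close>.\<close>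
  have "F 1 * exp (- G 1) \<le> F 0 * exp (- G 0)"
  proof (rule DERIV_nonpos_imp_nonincreasing[of 0 1 "\<lambda>x. F x * exp (- G x)"])
    fix x :: real assume "0 \<le> x" "x \<le> 1"
    have "((\<lambda>x. F x * exp (- G x)) has_field_derivative (F' x - G' x * F x) * exp (- G x)) (at x)"
      by (auto intro!: derivative_eq_intros F G simp: algebra_simps)
    moreover have "(F' x - G' x * F x) * exp (- G x) \<le> 0"
      using le[OF \<open>0 \<le> x\<close>] by (intro mult_nonpos_nonneg) auto
    ultimately show "\<exists>y. ((\<lambda>x. F x * exp (- G x)) has_field_derivative y) (at x) \<and> y \<le> 0" by blast
  qed auto
  also have "F 0 = 1" unfolding F_def by (simp add: power_0_left if_distrib sum.delta cong: if_cong)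
  also have "G 0 = 0" unfolding G_def by (intro sum.neutral) auto
  finally have "F 1 \<le> exp (G 1)" by (simp add: exp_minus field_simps)
  then show ?thesis by (simp add: F_def G_def)
qed

text \<open>Both bounds follow from \<open>1 / (b + 1) <= ln ((b + 1) / b) <= 1 / b\<close>,
  obtained by applying \<open>ln x <= x - 1\<close> to the ratio and to its reciprocal. The
  correction \<open>1 / a - 1 / b\<close> comes from shifting the summation range by one.\<close>

lemma harmonic_block_bounds:
  fixes a b :: nat
  assumes "0 < a" "a \<le> b"
  shows "ln (b / a) \<le> (\<Sum>j=a..<b. 1 / j)" and "(\<Sum>j=a..<b. 1 / j) \<le> 1 / a + ln (b / a) - 1 / b"
proof -
  have "ln (b / a) \<le> (\<Sum>j=a..<b. 1 / j) \<and> (\<Sum>j=a..<b. 1 / j) \<le> 1 / a + ln (b / a) - 1 / b"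
    using assms(2)
  proof (induction b rule: dec_induct)
    case base
    then show ?case using assms(1) by simp
  next
    case (step b)
    define t where "t = ln (real (Suc b) / b)"
    have b: "b > 0" using step assms by auto
    have t: "ln (real (Suc b) / a) = ln (real b / a) + t"
      using b assms(1) by (simp add: t_def ln_div)
    have "t \<le> real (Suc b) / b - 1" unfolding t_def using b by (intro ln_le_minus_one) auto
    moreover have "real (Suc b) / b - 1 = 1 / b" using b by (simp add: field_simps)
    moreover have "ln (b / real (Suc b)) \<le> b / real (Suc b) - 1" using b by (intro ln_le_minus_one) auto
    moreover have "ln (b / real (Suc b)) = - t" unfolding t_def using b by (simp add: ln_div)
    moreover have "b / real (Suc b) - 1 = - (1 / real (Suc b))" by (simp add: field_simps)
    ultimately have "t \<le> 1 / b" "1 / real (Suc b) \<le> t" by linarith+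
    moreover have "(\<Sum>j=a..<Suc b. 1 / real j) = (\<Sum>j=a..<b. 1 / real j) + 1 / b"
      using step.hyps by simp
    ultimately show ?case using step.IH unfolding t by linarith
  qed
  then show "ln (b / a) \<le> (\<Sum>j=a..<b. 1 / j)" "(\<Sum>j=a..<b. 1 / j) \<le> 1 / a + ln (b / a) - 1 / b"
    by auto
qed

text \<open>Bounding \<open>w j\<close> by \<open>W\<close> in the recurrence leaves a partial sum
  of mean weights. The harmonic sum inside the exponential is at most \<open>1 + ln n\<close>; its
  \<open>n\<close> cancels the factor on the left, and \<open>exp 1 <= 3\<close> gives the
  constant.\<close>

lemma mean_weight_le_exp:
  assumes w: "\<And>j. w j \<ge> 0" and W: "\<And>j. w j \<le> W" and "n > 0"
  shows "mean_weight w n \<le> 3 * W * exp (\<Sum>j=1..n. (w j - 1) / j)"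
proof -
  have "W \<ge> 0" using w[of 0] W[of 0] by linarith
  have "n * mean_weight w n \<le> (\<Sum>j=1..n. W * mean_weight w (n - j))"
    unfolding mean_weight_recurrence
    by (intro sum_mono mult_right_mono W mean_weight_nonneg w)
  also have "\<dots> = W * (\<Sum>m<n. mean_weight w m)"
    unfolding sum_distrib_left
    by (rule sum.reindex_bij_witness[where i = "\<lambda>m. n - m" and j = "\<lambda>j. n - j"]) auto
  also have "\<dots> \<le> W * (\<Sum>m\<le>n. mean_weight w m)"
    by (intro mult_left_mono sum_mono2 \<open>W \<ge> 0\<close>) (auto intro: mean_weight_nonneg w)
  also have "\<dots> \<le> W * exp (\<Sum>j=1..n. w j / j)"
    by (intro mult_left_mono sum_mean_weight_le_exp w \<open>W \<ge> 0\<close>)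
  also have "(\<Sum>j=1..n. w j / j) = (\<Sum>j=1..n. (w j - 1) / j) + (\<Sum>j=1..n. 1 / j)"
    by (simp add: diff_divide_distrib sum_subtractf)
  also have "(\<Sum>j=1..n. 1 / real j) = (\<Sum>j=1..<n. 1 / real j) + 1 / n"
    using \<open>n > 0\<close> by (simp add: sum.last_plus atLeastLessThanSuc_atLeastAtMost[symmetric])
  also have "W * exp ((\<Sum>j=1..n. (w j - 1) / j) + ((\<Sum>j=1..<n. 1 / real j) + 1 / n))
      \<le> W * exp ((\<Sum>j=1..n. (w j - 1) / j) + (1 + ln n))"
    using harmonic_block_bounds(2)[of 1 n] \<open>n > 0\<close> \<open>W \<ge> 0\<close> by (intro mult_left_mono) auto
  also have "\<dots> = n * (exp 1 * W * exp (\<Sum>j=1..n. (w j - 1) / j))"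
    using \<open>n > 0\<close> by (simp add: exp_add)
  also have "\<dots> \<le> n * (3 * W * exp (\<Sum>j=1..n. (w j - 1) / j))"
    using \<open>W \<ge> 0\<close> exp_le by (intro mult_left_mono mult_right_mono) auto
  finally show ?thesis using \<open>n > 0\<close> by simp
qed

text \<open>The value 0 excludes permutations with a cycle shorter than \<open>2 ^ L\<close>; on the
  others the cycle weight is \<open>v\<close> to the number of cycles shorter than
  \<open>2 ^ i\<close>. Taking \<open>v = 16 / 15\<close> penalises many such cycles, and
  \<open>v = 1 / 2\<close> exploits that there are few.\<close>

definition band_weight :: "nat \<Rightarrow> nat \<Rightarrow> real \<Rightarrow> nat \<Rightarrow> real" where
  "band_weight L i v j = (if j < 2 ^ L then 0 else if j < 2 ^ i then v else 1)"

text \<open>The excluded lengths contribute minus a harmonic sum of at least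
  \<open>ln (2 ^ L)\<close> to the exponent, hence the factor \<open>1 / 2 ^ L\<close>. Lengths from
  \<open>2 ^ i\<close> on have weight 1 and contribute nothing.\<close>

lemma mean_weight_band_le:
  assumes "v \<ge> 0" "L \<le> i" "2 ^ i \<le> n"
  shows "mean_weight (band_weight L i v) n \<le>
    3 * max 1 v * exp ((v - 1) * (\<Sum>j=2^L..<2^i. 1 / real j)) / 2 ^ L"
proof -
  have n: "n > 0" using assms(3) by (metis gr0I le_zero_eq power_not_zero zero_neq_numeral)
  have L: "(2::nat) ^ L \<le> 2 ^ i" using assms by simp
  let ?w = "band_weight L i v"
  have "mean_weight ?w n \<le> 3 * max 1 v * exp (\<Sum>j=1..n. (?w j - 1) / j)"
    by (rule mean_weight_le_exp) (use assms n in \<open>auto simp: band_weight_def\<close>)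
  also have "(\<Sum>j=1..n. (?w j - 1) / j) = (\<Sum>j\<in>{1..<2^L} \<union> {2^L..<2^i}. (?w j - 1) / j)"
  proof (rule sum.mono_neutral_right)
    have subset: "{1..<a} \<union> {a..<b} \<subseteq> {1..n}" if "0 < a" "a \<le> b" "b \<le> n" for a b :: nat
      using that by auto
    show "{1..<2 ^ L} \<union> {2 ^ L..<2 ^ i} \<subseteq> {1..n}"
      by (rule subset) (use L assms(3) in auto)
  qed (auto simp: band_weight_def)
  also have "\<dots> = (\<Sum>j=1..<2^L. (?w j - 1) / j) + (\<Sum>j=2^L..<2^i. (?w j - 1) / j)"
    by (rule sum.union_disjoint) auto
  also have "(\<Sum>j=1..<2^L. (?w j - 1) / j) = - (\<Sum>j=1..<2^L. 1 / real j)"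
    by (simp add: band_weight_def sum_negf[symmetric])
  also have "(\<Sum>j=2^L..<2^i. (?w j - 1) / j) = (v - 1) * (\<Sum>j=2^L..<2^i. 1 / real j)"
    by (simp add: band_weight_def sum_distrib_left)
  also have "3 * max 1 v * exp (- (\<Sum>j=1..<2^L. 1 / real j) + (v - 1) * (\<Sum>j=2^L..<2^i. 1 / real j))
    \<le> 3 * max 1 v * exp (- ln (2 ^ L) + (v - 1) * (\<Sum>j=2^L..<2^i. 1 / real j))"
    using harmonic_block_bounds(1)[of 1 "2 ^ L"] by (intro mult_left_mono) auto
  also have "\<dots> = 3 * max 1 v * exp ((v - 1) * (\<Sum>j=2^L..<2^i. 1 / real j)) / 2 ^ L"
    by (simp only: exp_add exp_minus) (simp add: divide_inverse)
  finally show ?thesis .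
qed

lemma mean_weight_band_half_le:
  assumes "L \<le> i" "2 ^ i \<le> n"
  shows "mean_weight (band_weight L i (1 / 2)) n \<le> 3 * 2 powr (- (real L + real i) / 2)"
proof -
  have "ln (real (2 ^ i) / real (2 ^ L)) \<le> (\<Sum>j=2^L..<2^i. 1 / real j)"
    by (rule harmonic_block_bounds) (use assms in auto)
  moreover have "ln (real (2 ^ i) / real (2 ^ L)) = (real i - real L) * ln 2"
    by (simp add: ln_div ln_realpow algebra_simps)
  ultimately have S: "(1 / 2 - 1) * (\<Sum>j=2^L..<2^i. 1 / real j) \<le> - (real i - real L) / 2 * ln 2"
    by (simp only:) (simp add: algebra_simps)
  have "mean_weight (band_weight L i (1 / 2)) n \<le>
     3 * exp ((1 / 2 - 1) * (\<Sum>j=2^L..<2^i. 1 / real j)) / 2 ^ L"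
    using mean_weight_band_le[of "1 / 2" L i n] assms by simp
  also have "\<dots> \<le> 3 * exp (- (real i - real L) / 2 * ln 2) / 2 ^ L"
    using S by (intro divide_right_mono mult_left_mono) (simp_all del: times_divide_eq_left)
  also have "exp (- (real i - real L) / 2 * ln 2) = 2 powr (- (real i - real L) / 2)"
    by (simp add: powr_def)
  also have "3 * 2 powr (- (real i - real L) / 2) / 2 ^ L = 3 * 2 powr (- (real i - real L) / 2 - L)"
    by (simp add: powr_diff powr_realpow)
  also have "- (real i - real L) / 2 - L = - (real L + real i) / 2" by (simp add: field_simps)
  finally show ?thesis .
qed

lemma mean_weight_band_large_le:
  assumes "L \<le> i" "2 ^ i \<le> n"
  shows "mean_weight (band_weight L i (16 / 15)) n \<le> 10 * 2 powr (real i / 15) / 2 ^ L"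
proof -
  have "(\<Sum>j=2^L..<2^i. 1 / real j) \<le> 1 / real (2 ^ L) + ln (real (2 ^ i) / real (2 ^ L)) - 1 / real (2 ^ i)"
    by (rule harmonic_block_bounds) (use assms in auto)
  moreover have "ln (real (2 ^ i) / real (2 ^ L)) = real i * ln 2 - real L * ln 2"
    by (simp add: ln_div ln_realpow algebra_simps)
  moreover have "1 / real (2 ^ L) \<le> 1" "1 / real (2 ^ i) \<ge> 0" "real L * ln 2 \<ge> 0" by auto
  ultimately have "(\<Sum>j=2^L..<2^i. 1 / real j) \<le> 1 + real i * ln 2" by linarith
  then have S: "(16 / 15 - 1) * (\<Sum>j=2^L..<2^i. 1 / real j) \<le> 1 + real i / 15 * ln 2" by simp
  have "mean_weight (band_weight L i (16 / 15)) n \<le>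
     3 * (16 / 15) * exp ((16 / 15 - 1) * (\<Sum>j=2^L..<2^i. 1 / real j)) / 2 ^ L"
    using mean_weight_band_le[of "16 / 15" L i n] assms by simp
  also have "\<dots> \<le> 3 * (16 / 15) * exp (1 + real i / 15 * ln 2) / 2 ^ L"
    using S by (intro divide_right_mono mult_left_mono) (simp_all del: times_divide_eq_left)
  also have "\<dots> = 3 * (16 / 15) * exp 1 * exp (real i / 15 * ln 2) / 2 ^ L"
    by (simp add: exp_add)
  \<comment> \<open>With \<open>exp 1 <= 3\<close> the constant is at most
    \<open>9.6\<close>.\<close>
  also have "\<dots> \<le> 10 * exp (real i / 15 * ln 2) / 2 ^ L"
    using exp_le by (intro divide_right_mono mult_right_mono) auto
  also have "exp (real i / 15 * ln 2) = 2 powr (real i / 15)" by (simp add: powr_def)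
  finally show ?thesis .
qed

text \<open>The recurrence reads \<open>n * a n = (a 0 + ... + a (n - K))\<close>. The terms with
  \<open>0 < m < K\<close> are dropped, those with \<open>m >= K\<close> are bounded by induction,
  and \<open>a 0 = 1\<close> makes up for about \<open>2 * K\<close> missing terms.\<close>

lemma mean_weight_no_short_ge:
  assumes "n \<ge> K" "K > 0"
  shows "mean_weight (\<lambda>j. if j < K then 0 else 1) n \<ge> 1 / (2 * real K)"
  using assms(1)
proof (induction n rule: less_induct)
  case (less n)
  let ?a = "mean_weight (\<lambda>j. if j < K then 0 else 1)"
  have n: "n > 0" using less assms by auto
  have nonneg: "?a m \<ge> 0" for m by (rule mean_weight_nonneg) auto
  have "n * ?a n = (\<Sum>j=1..n. (if j < K then 0 else 1) * ?a (n - j))"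
    by (rule mean_weight_recurrence)
  also have "\<dots> = (\<Sum>j=K..n. ?a (n - j))"
    by (rule sum.mono_neutral_cong_right) (use assms in auto)
  also have "\<dots> = (\<Sum>m=0..n-K. ?a m)"
    by (rule sum.reindex_bij_witness[where i = "\<lambda>m. n - m" and j = "\<lambda>j. n - j"]) (use less.prems in auto)
  also have "\<dots> \<ge> (\<Sum>m\<in>insert 0 {K..n-K}. ?a m)"
    by (rule sum_mono2) (use nonneg in auto)
  finally have 1: "n * ?a n \<ge> 1 + (\<Sum>m=K..n-K. ?a m)" using assms(2) by simp
  have "(\<Sum>m=K..n-K. ?a m) \<ge> (\<Sum>m=K..n-K. 1 / (2 * real K))"
  proof (rule sum_mono)
    fix m assume "m \<in> {K..n-K}"
    then have "K \<le> m" "m < n" using n assms(2) by auto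
    then show "1 / (2 * real K) \<le> ?a m" by (intro less.IH)
  qed
  then have "n * ?a n \<ge> 1 + real (n - K + 1 - K) / (2 * real K)" using 1 by simp
  moreover have "1 + real (n - K + 1 - K) / (2 * real K) \<ge> n / (2 * real K)"
  proof -
    \<comment> \<open>This also holds when the natural subtraction truncates, that is, when the
      range from \<open>K\<close> to \<open>n - K\<close> is empty.\<close>
    have "real n \<le> 2 * K + real (n - K + 1 - K)" by linarith
    then have "real n / (2 * real K) \<le> (2 * K + real (n - K + 1 - K)) / (2 * real K)"
      by (intro divide_right_mono) auto
    then show ?thesis using assms(2) by (simp add: add_divide_distrib)
  qed
  ultimately have "n * ?a n \<ge> n * (1 / (2 * real K))" by simp
  then show ?case using n by (simp only: mult_le_cancel_left_pos of_nat_0_less_iff)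
qed

section \<open>Random permutations\<close>

lemma prob_uniform_perm:
  "measure_pmf.prob (uniform_perm N) E = card {\<sigma>. \<sigma> permutes {1..N} \<and> \<sigma> \<in> E} / fact N"
proof -
  have "{\<sigma>. \<sigma> permutes {1..N}} \<noteq> {}" using permutes_id by blast
  then show ?thesis unfolding uniform_perm_def
    by (subst measure_pmf_of_set)
      (simp_all add: finite_permutations card_permutations[of "{1..N}" N] Int_def del: One_nat_def)
qed

lemma cycle_weight_nonneg:
  assumes "\<And>j. w j \<ge> 0"
  shows "cycle_weight w A \<sigma> \<ge> 0"
  unfolding cycle_weight_def by (intro prod_nonneg) (use assms in auto)

text \<open>Markov's inequality for the cycle weight.\<close>

lemma prob_le_mean_weight:
  assumes w: "\<And>j. w j \<ge> 0" and "c > 0"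
    and c: "\<And>\<sigma>. \<sigma> permutes {1..N} \<Longrightarrow> \<sigma> \<in> E \<Longrightarrow> c \<le> cycle_weight w {1..N} \<sigma>"
  shows "measure_pmf.prob (uniform_perm N) E \<le> mean_weight w N / c"
proof -
  have "card {\<sigma>. \<sigma> permutes {1..N} \<and> \<sigma> \<in> E} * c = (\<Sum>\<sigma> | \<sigma> permutes {1..N} \<and> \<sigma> \<in> E. c)"
    by simp
  also have "\<dots> \<le> (\<Sum>\<sigma> | \<sigma> permutes {1..N} \<and> \<sigma> \<in> E. cycle_weight w {1..N} \<sigma>)"
    by (intro sum_mono) (use c in auto)
  also have "\<dots> \<le> total_weight w {1..N}"
    unfolding total_weight_def
    by (rule sum_mono2) (use w in \<open>auto simp: finite_permutations intro: cycle_weight_nonneg\<close>)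
  also have "\<dots> = fact N * mean_weight w N" by (simp add: total_weight_eq)
  finally show ?thesis using \<open>c > 0\<close> by (simp add: prob_uniform_perm field_simps)
qed

text \<open>Union bound over the \<open>k\<close>-sets \<open>I\<close>, with Markov's inequality on
  the permutations preserving \<open>I\<close>. The weight factors over \<open>I\<close> and its
  complement, and the number of \<open>k\<close>-sets cancels the factorials.\<close>

lemma prob_invariant_size_le:
  assumes w: "\<And>j. w j \<ge> 0" and "c > 0" and "k \<le> N"
    and c: "\<And>\<sigma>. \<sigma> permutes {1..N} \<Longrightarrow> \<sigma> \<in> E \<Longrightarrow> c \<le> cycle_weight w {1..N} \<sigma>"
  shows "measure_pmf.prob (uniform_perm N) {\<sigma> \<in> E. k \<in> invariant_sizes N \<sigma>}
    \<le> mean_weight w k * mean_weight w (N - k) / c"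
proof -
  let ?A = "{1..N}"
  let ?I = "{I. I \<subseteq> ?A \<and> card I = k}"
  let ?P = "\<lambda>I. {\<sigma>. \<sigma> permutes ?A \<and> \<sigma> \<in> E \<and> \<sigma> ` I = I}"
  have "real (card {\<sigma>. \<sigma> permutes ?A \<and> \<sigma> \<in> {\<sigma> \<in> E. k \<in> invariant_sizes N \<sigma>}}) \<le> card (\<Union>I\<in>?I. ?P I)"
    by (intro of_nat_mono card_mono)
      (auto simp: invariant_sizes_def finite_permutations intro!: finite_subset[of "\<Union>I\<in>?I. ?P I" "{\<sigma>. \<sigma> permutes ?A}"])
  also have "\<dots> \<le> (\<Sum>I\<in>?I. real (card (?P I)))"
    using card_UN_le[of ?I ?P] by (simp flip: of_nat_sum)
  finally have "card {\<sigma>. \<sigma> permutes ?A \<and> \<sigma> \<in> {\<sigma> \<in> E. k \<in> invariant_sizes N \<sigma>}} * c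
      \<le> (\<Sum>I\<in>?I. card (?P I) * c)"
    using \<open>c > 0\<close> by (simp flip: sum_distrib_right)
  also have "\<dots> \<le> (\<Sum>I\<in>?I. fact k * fact (N - k) * (mean_weight w k * mean_weight w (N - k)))"
  proof (intro sum_mono)
    fix I assume I: "I \<in> ?I"
    have "card (?P I) * c = (\<Sum>\<sigma>\<in>?P I. c)" by simp
    also have "\<dots> \<le> (\<Sum>\<sigma>\<in>?P I. cycle_weight w ?A \<sigma>)"
      by (intro sum_mono) (use c in auto)
    also have "\<dots> \<le> (\<Sum>\<sigma> | \<sigma> permutes ?A \<and> \<sigma> ` I = I. cycle_weight w ?A \<sigma>)"
      by (rule sum_mono2) (use w in \<open>auto simp: finite_permutations intro: cycle_weight_nonneg\<close>)
    also have "\<dots> = total_weight w I * total_weight w (?A - I)"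
      by (rule sum_invariant_cycle_weight) (use I in auto)
    also have "\<dots> = fact k * fact (N - k) * (mean_weight w k * mean_weight w (N - k))"
      using I finite_subset[of I ?A] by (auto simp: total_weight_eq card_Diff_subset)
    finally show "card (?P I) * c \<le> fact k * fact (N - k) * (mean_weight w k * mean_weight w (N - k))" .
  qed
  also have "\<dots> = real (N choose k) * (fact k * fact (N - k)) * (mean_weight w k * mean_weight w (N - k))"
    by (simp add: n_subsets)
  also have "real (N choose k) * (fact k * fact (N - k)) = fact N"
    using binomial_fact[OF \<open>k \<le> N\<close>, where 'a = real] by simp
  finally show ?thesis using \<open>c > 0\<close> by (simp add: prob_uniform_perm field_simps)
qed

section \<open>Permutations with few cycles at every dyadic scale\<close>

definition no_short_cycles :: "nat \<Rightarrow> nat \<Rightarrow> (nat \<Rightarrow> nat) set" where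
  "no_short_cycles L N = {\<sigma>. \<forall>C\<in>orbit \<sigma> ` {1..N}. 2 ^ L \<le> card C}"

definition num_cycles_below :: "nat \<Rightarrow> nat \<Rightarrow> (nat \<Rightarrow> nat) \<Rightarrow> nat" where
  "num_cycles_below i N \<sigma> = card {C \<in> orbit \<sigma> ` {1..N}. card C < 2 ^ i}"

text \<open>The ratio \<open>11 / 15\<close> lies between \<open>ln 2\<close>, the typical density
  of cycles per scale, and \<open>3 / 4\<close>, below which the fourth power of the final bound
  outweighs the \<open>2 ^ i\<close> sizes at scale \<open>i\<close>.\<close>

definition sparse_perms :: "nat \<Rightarrow> nat \<Rightarrow> (nat \<Rightarrow> nat) set" where
  "sparse_perms L N = {\<sigma> \<in> no_short_cycles L N. \<sigma> permutes {1..N} \<and>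
     (\<forall>i. L \<le> i \<and> 2 ^ i \<le> N \<longrightarrow> 15 * num_cycles_below i N \<sigma> \<le> 11 * i)}"

lemma cycle_weight_band:
  assumes "\<sigma> \<in> no_short_cycles L N"
  shows "cycle_weight (band_weight L i v) {1..N} \<sigma> = v ^ num_cycles_below i N \<sigma>"
proof -
  have "cycle_weight (band_weight L i v) {1..N} \<sigma>
      = (\<Prod>C\<in>orbit \<sigma> ` {1..N}. if card C < 2 ^ i then v else 1)"
    unfolding cycle_weight_def
    by (intro prod.cong refl) (use assms in \<open>auto simp: no_short_cycles_def band_weight_def\<close>)
  also have "\<dots> = v ^ num_cycles_below i N \<sigma>"
    by (simp add: num_cycles_below_def prod.If_cases Int_def)
  finally show ?thesis .
qed

text \<open>For this 0-1 weight the cycle weight is the indicator of the event, so the probability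
  equals the mean weight.\<close>

lemma prob_no_short_cycles_ge:
  assumes "2 ^ L \<le> N"
  shows "measure_pmf.prob (uniform_perm N) (no_short_cycles L N) \<ge> 1 / (2 * 2 ^ L)"
proof -
  let ?w = "\<lambda>j::nat. if j < 2 ^ L then 0 else 1 :: real"
  have "cycle_weight ?w {1..N} \<sigma> = of_bool (\<sigma> \<in> no_short_cycles L N)" for \<sigma>
    by (auto simp: cycle_weight_def no_short_cycles_def not_less intro!: prod.neutral prod_zero)
  then have "total_weight ?w {1..N} = card {\<sigma>. \<sigma> permutes {1..N} \<and> \<sigma> \<in> no_short_cycles L N}"
    by (simp add: total_weight_def finite_permutations Int_def)
  then have "measure_pmf.prob (uniform_perm N) (no_short_cycles L N) = mean_weight ?w N"
    by (simp add: prob_uniform_perm total_weight_eq field_simps)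
  then show ?thesis using mean_weight_no_short_ge[OF assms] by simp
qed

text \<open>
  Markov's inequality with weight \<open>v = 16 / 15\<close> bounds the probability of more than \<open>11 i / 15\<close> cycles
  shorter than \<open>2 ^ i\<close> by a multiple of \<open>(2 powr (v - 1) / v powr (11 / 15)) ^ i\<close>.
\<close>

definition tail_ratio :: real where
  "tail_ratio = (2 / (16 / 15) ^ 11) powr (1 / 15)"

lemma tail_ratio: "0 < tail_ratio" "tail_ratio < 1"
proof -
  show "0 < tail_ratio" by (simp add: tail_ratio_def)
  \<comment> \<open>The numerical fact is \<open>2 < (16 / 15) ^ 11\<close>.\<close>
  have "(2 / (16 / 15) ^ 11 :: real) powr (1 / 15) < 1 powr (1 / 15)"
    by (intro powr_less_mono2) (simp_all add: power_divide)
  then show "tail_ratio < 1" by (simp add: tail_ratio_def)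
qed

lemma prob_many_cycles_le:
  assumes "L \<le> i" "2 ^ i \<le> N"
  shows "measure_pmf.prob (uniform_perm N)
    {\<sigma> \<in> no_short_cycles L N. 11 * i < 15 * num_cycles_below i N \<sigma>} \<le> 10 / 2 ^ L * tail_ratio ^ i"
proof -
  let ?c = "(16 / 15 :: real) powr (11 * real i / 15)"
  have "measure_pmf.prob (uniform_perm N)
    {\<sigma> \<in> no_short_cycles L N. 11 * i < 15 * num_cycles_below i N \<sigma>}
    \<le> mean_weight (band_weight L i (16 / 15)) N / ?c"
  proof (rule prob_le_mean_weight)
    fix \<sigma> assume \<sigma>: "\<sigma> \<in> {\<sigma> \<in> no_short_cycles L N. 11 * i < 15 * num_cycles_below i N \<sigma>}"
    then have "real (11 * i) \<le> real (15 * num_cycles_below i N \<sigma>)" by (subst of_nat_le_iff) auto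
    then have "?c \<le> (16 / 15) powr (num_cycles_below i N \<sigma>)"
      by (intro powr_mono) auto
    then show "?c \<le> cycle_weight (band_weight L i (16 / 15)) {1..N} \<sigma>"
      using \<sigma> by (simp add: cycle_weight_band powr_realpow del: One_nat_def)
  qed (auto simp: band_weight_def)
  also have "\<dots> \<le> 10 * 2 powr (real i / 15) / 2 ^ L / ?c"
    by (intro divide_right_mono mean_weight_band_large_le assms) auto
  also have "\<dots> = 10 / 2 ^ L * (2 powr (real i / 15) / ?c)" by simp
  also have "2 powr (real i / 15) / ?c = tail_ratio ^ i"
  proof -
    have "?c = ((16 / 15) powr 11) powr (i / 15)" by (simp only: powr_powr) simp
    also have "(16 / 15 :: real) powr 11 = (16 / 15) ^ 11"
      by simp
    finally have "2 powr (real i / 15) / ?c = (2 / (16 / 15) ^ 11) powr (i / 15)"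
      by (simp add: powr_divide)
    also have "\<dots> = tail_ratio powr i" by (simp add: tail_ratio_def powr_powr)
    finally show ?thesis using tail_ratio by (simp add: powr_realpow)
  qed
  finally show ?thesis .
qed

lemma sum_power_le_geometric:
  fixes q :: real
  assumes "0 < q" "q < 1" "finite S" "S \<subseteq> {L..}"
  shows "(\<Sum>i\<in>S. q ^ i) \<le> q ^ L / (1 - q)"
proof -
  have sums: "(\<lambda>i. q ^ L * q ^ i) sums (q ^ L * (1 / (1 - q)))"
    by (intro sums_mult geometric_sums) (use assms in auto)
  have "(\<Sum>i\<in>S. q ^ i) = (\<Sum>i\<in>(\<lambda>i. i - L) ` S. q ^ L * q ^ i)"
  proof (subst sum.reindex)
    show "inj_on (\<lambda>i. i - L) S" using assms(4) inj_on_diff_nat[of S L] by blast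
    show "(\<Sum>i\<in>S. q ^ i) = sum ((\<lambda>i. q ^ L * q ^ i) \<circ> (\<lambda>i. i - L)) S"
      using assms(4) by (intro sum.cong refl) (auto simp flip: power_add)
  qed
  also have "\<dots> \<le> (\<Sum>i. q ^ L * q ^ i)"
    by (rule sum_le_suminf) (use sums assms in \<open>auto simp: sums_iff\<close>)
  also have "\<dots> = q ^ L / (1 - q)" using sums by (simp add: sums_iff)
  finally show ?thesis .
qed

text \<open>Union bound over the scales. The failure probability carries the same factor
  \<open>1 / 2 ^ L\<close> as the probability of having no short cycles, so for large
  \<open>L\<close> it is only a small fraction of the latter.\<close>

lemma prob_sparse_perms_ge:
  assumes "2 ^ L \<le> N"
  shows "measure_pmf.prob (uniform_perm N) (sparse_perms L N)
    \<ge> (1 / 2 - 10 * (tail_ratio ^ L / (1 - tail_ratio))) / 2 ^ L"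
proof -
  let ?p = "measure_pmf.prob (uniform_perm N)"
  let ?S = "{i. L \<le> i \<and> 2 ^ i \<le> N}"
  let ?bad = "\<lambda>i. {\<sigma> \<in> no_short_cycles L N. 11 * i < 15 * num_cycles_below i N \<sigma>}"
  let ?perms = "{\<sigma>. \<sigma> permutes {1..N}}"
  have fin: "finite ?S"
  proof (rule finite_subset)
    show "?S \<subseteq> {..N}"
    proof clarsimp
      fix i :: nat assume "2 ^ i \<le> N"
      moreover have "i < 2 ^ i" by (rule less_exp)
      ultimately show "i \<le> N" by linarith
    qed
  qed simp
  \<comment> \<open>\<open>no_short_cycles\<close> also contains functions that do not permute
    \<open>{1..N}\<close>; they form a null set in the cover below.\<close>
  have "?p (- ?perms) = 0"
    by (simp add: prob_uniform_perm)
  have "1 / (2 * 2 ^ L) \<le> ?p (no_short_cycles L N)" by (rule prob_no_short_cycles_ge[OF assms])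
  also have "\<dots> \<le> ?p ((sparse_perms L N \<union> - ?perms) \<union> (\<Union>i\<in>?S. ?bad i))"
    by (rule measure_pmf.finite_measure_mono) (auto simp: sparse_perms_def not_le)
  also have "\<dots> \<le> ?p (sparse_perms L N \<union> - ?perms) + ?p (\<Union>i\<in>?S. ?bad i)"
    by (rule measure_Un_le) auto
  also have "?p (sparse_perms L N \<union> - ?perms) \<le> ?p (sparse_perms L N) + ?p (- ?perms)"
    by (rule measure_Un_le) auto
  also have "?p (\<Union>i\<in>?S. ?bad i) \<le> (\<Sum>i\<in>?S. ?p (?bad i))"
    by (rule measure_UNION_le) (use fin in auto)
  also have "\<dots> \<le> (\<Sum>i\<in>?S. 10 / 2 ^ L * tail_ratio ^ i)"
    by (intro sum_mono prob_many_cycles_le) auto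
  also have "\<dots> = 10 / 2 ^ L * (\<Sum>i\<in>?S. tail_ratio ^ i)" by (simp add: sum_distrib_left)
  also have "\<dots> \<le> 10 / 2 ^ L * (tail_ratio ^ L / (1 - tail_ratio))"
    by (intro mult_left_mono sum_power_le_geometric tail_ratio fin) auto
  finally have "1 / (2 * 2 ^ L) \<le> ?p (sparse_perms L N) + 10 / 2 ^ L * (tail_ratio ^ L / (1 - tail_ratio))"
    using \<open>?p (- ?perms) = 0\<close> by simp
  moreover have split: "(1 / 2 - 10 * x) / y = 1 / (2 * y) - 10 / y * x" for x y :: real
    by (simp add: diff_divide_distrib)
  ultimately show ?thesis unfolding split by linarith
qed

text \<open>With \<open>v = 1 / 2\<close>, sparseness bounds the weight below by
  \<open>2 powr (- 11 i / 15)\<close>. The invariant set and its complement both have at least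
  \<open>2 ^ i\<close> elements, and each contributes \<open>3 * 2 powr (- (L + i) / 2)\<close>; the
  quotient leaves the exponent \<open>- L - 4 i / 15\<close>.\<close>

lemma prob_sparse_invariant_size_le:
  assumes "L \<le> i" "2 ^ i \<le> k" "2 * k \<le> N"
  shows "measure_pmf.prob (uniform_perm N) {\<sigma> \<in> sparse_perms L N. k \<in> invariant_sizes N \<sigma>}
    \<le> 9 / 2 ^ L * 2 powr (- (4 * real i / 15))"
proof -
  let ?w = "band_weight L i (1 / 2)"
  let ?c = "2 powr (- (11 * real i / 15)) :: real"
  have N: "2 ^ i \<le> N" "2 ^ i \<le> N - k" "k \<le> N" using assms by auto
  have "measure_pmf.prob (uniform_perm N) {\<sigma> \<in> sparse_perms L N. k \<in> invariant_sizes N \<sigma>}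
      \<le> mean_weight ?w k * mean_weight ?w (N - k) / ?c"
  proof (rule prob_invariant_size_le)
    fix \<sigma> assume \<sigma>: "\<sigma> \<in> sparse_perms L N"
    let ?m = "num_cycles_below i N \<sigma>"
    have "15 * ?m \<le> 11 * i" using \<sigma> assms N by (auto simp: sparse_perms_def)
    then have "real (15 * ?m) \<le> real (11 * i)" by (subst of_nat_le_iff)
    then have "?c \<le> 2 powr (- real ?m)" by (intro powr_mono) auto
    also have "\<dots> = (1 / 2) ^ ?m" by (simp add: powr_minus powr_realpow power_one_over inverse_eq_divide)
    also have "\<dots> = cycle_weight ?w {1..N} \<sigma>"
      using \<sigma> by (simp add: cycle_weight_band sparse_perms_def del: One_nat_def)
    finally show "?c \<le> cycle_weight ?w {1..N} \<sigma>" .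
  qed (use N in \<open>auto simp: band_weight_def\<close>)
  also have "\<dots> \<le> (3 * 2 powr (- (real L + real i) / 2)) * (3 * 2 powr (- (real L + real i) / 2)) / ?c"
    by (intro divide_right_mono mult_mono mean_weight_band_half_le mean_weight_nonneg)
      (use assms N in \<open>auto simp: band_weight_def\<close>)
  also have "\<dots> = 9 * 2 powr (- (real L + real i) / 2 + - (real L + real i) / 2 - - (11 * real i / 15))"
    by (simp only: powr_add powr_diff)
  also have "- (real L + real i) / 2 + - (real L + real i) / 2 - - (11 * real i / 15) = - (4 * real i / 15) - real L"
    by (simp add: field_simps)
  also have "9 * 2 powr (- (4 * real i / 15) - real L) = 9 / 2 ^ L * 2 powr (- (4 * real i / 15))"
    by (simp add: powr_diff powr_realpow)
  finally show ?thesis .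
qed

section \<open>Elementary properties of invariant sizes\<close>

lemma invariant_sizes_bounds:
  assumes "k \<in> invariant_sizes N \<sigma>"
  shows "0 < k" "k < N"
proof -
  obtain I where "k = card I" "I \<noteq> {}" "I \<subset> {1..N}" using assms by (auto simp: invariant_sizes_def)
  then show "0 < k" "k < N" using psubset_card_mono[of "{1..N}" I] finite_subset[of I "{1..N}"]
    by (auto simp: card_gt_0_iff)
qed

lemma invariant_sizes_complement:
  assumes "\<sigma> permutes {1..N}" "k \<in> invariant_sizes N \<sigma>"
  shows "N - k \<in> invariant_sizes N \<sigma>"
proof -
  obtain I where I: "k = card I" "I \<noteq> {}" "I \<subset> {1..N}" "\<sigma> ` I = I"
    using assms(2) by (auto simp: invariant_sizes_def)
  have "N - k = card ({1..N} - I)" using I by (simp add: card_Diff_subset finite_subset[of I "{1..N}"])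
  moreover have "\<sigma> ` ({1..N} - I) = {1..N} - I"
    using I(4) by (simp add: image_set_diff permutes_inj[OF assms(1)] permutes_image[OF assms(1)] del: One_nat_def)
  ultimately show ?thesis unfolding invariant_sizes_def using I by blast
qed

lemma orbit_subset_invariant:
  assumes "\<sigma> ` I = I" "x \<in> I"
  shows "orbit \<sigma> x \<subseteq> I"
proof
  fix y assume "y \<in> orbit \<sigma> x"
  then show "y \<in> I" by induction (use assms in auto)
qed

text \<open>A nonempty invariant set contains the whole cycle of any of its points.\<close>

lemma invariant_sizes_no_short_cycles:
  assumes "\<sigma> \<in> no_short_cycles L N" "k \<in> invariant_sizes N \<sigma>"
  shows "2 ^ L \<le> k"
proof -
  obtain I x where I: "k = card I" "I \<subset> {1..N}" "\<sigma> ` I = I" "x \<in> I"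
    using assms(2) by (auto simp: invariant_sizes_def)
  have "2 ^ L \<le> card (orbit \<sigma> x)" using assms(1) I by (auto simp: no_short_cycles_def)
  also have "\<dots> \<le> k"
    unfolding I(1) using I finite_subset[of I "{1..N}"] by (intro card_mono orbit_subset_invariant) auto
  finally show ?thesis .
qed

text \<open>The \<open>(N - 1)!\<close> full cycles have no nontrivial invariant set. This serves
  the finitely many \<open>N\<close> below \<open>2 ^ L\<close>.\<close>

lemma prob_trivial_invariant_sizes_ge:
  assumes "N \<ge> 1"
  shows "measure_pmf.prob (uniform_perm N) {\<sigma>. invariant_sizes N \<sigma> = {}} \<ge> 1 / N"
proof -
  have "{\<sigma>. \<sigma> permutes {1..N} \<and> orbit \<sigma> 1 = {1..N}} \<subseteq> {\<sigma>. \<sigma> permutes {1..N} \<and> \<sigma> \<in> {\<sigma>. invariant_sizes N \<sigma> = {}}}"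
  proof clarify
    fix \<sigma> assume \<sigma>: "\<sigma> permutes {1..N}" "orbit \<sigma> 1 = {1..N}"
    have "I = {1..N}" if I: "I \<noteq> {}" "I \<subseteq> {1..N}" "\<sigma> ` I = I" for I
    proof -
      obtain x where x: "x \<in> I" using I by blast
      then have "orbit \<sigma> x = {1..N}"
        using orbit_cyclic_eq3[OF cyclic_on_orbit[OF \<sigma>(1), of 1]] \<sigma>(2) I by auto
      then show ?thesis using orbit_subset_invariant[OF I(3) x] I by auto
    qed
    then show "invariant_sizes N \<sigma> = {}" by (auto simp: invariant_sizes_def)
  qed
  then have "card {\<sigma>. \<sigma> permutes {1..N} \<and> orbit \<sigma> 1 = {1..N}}
      \<le> card {\<sigma>. \<sigma> permutes {1..N} \<and> \<sigma> \<in> {\<sigma>. invariant_sizes N \<sigma> = {}}}"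
    by (intro card_mono) (auto simp: finite_permutations)
  then have "fact (N - 1) \<le> card {\<sigma>. \<sigma> permutes {1..N} \<and> \<sigma> \<in> {\<sigma>. invariant_sizes N \<sigma> = {}}}"
    using assms by (simp add: card_cyclic_permutations del: One_nat_def)
  then have "real (fact (N - 1)) \<le> card {\<sigma>. \<sigma> permutes {1..N} \<and> \<sigma> \<in> {\<sigma>. invariant_sizes N \<sigma> = {}}}"
    by (subst of_nat_le_iff)
  then have "fact (N - 1) / fact N \<le> measure_pmf.prob (uniform_perm N) {\<sigma>. invariant_sizes N \<sigma> = {}}"
    unfolding prob_uniform_perm by (intro divide_right_mono) (auto simp del: One_nat_def)
  moreover have "fact (N - 1) / fact N = (1 / N :: real)"
    using assms by (simp add: fact_reduce[of N] del: of_nat_diff)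
  ultimately show ?thesis by simp
qed

section \<open>Four independent permutations\<close>

lemma prob_indep_uniform_perms:
  "measure_pmf.prob (indep_uniform_perms k N) (Pi {1..k} (\<lambda>_. E)) = measure_pmf.prob (uniform_perm N) E ^ k"
  unfolding indep_uniform_perms_def by (subst measure_Pi_pmf_Pi) auto

text \<open>All four permutations are sparse with probability at least
  \<open>1 / 256 / (2 ^ L) ^ 4\<close>, by \<open>tail\<close>. Sharing an invariant size as well
  costs a geometric series over the scales \<open>i >= L\<close>, which \<open>geom\<close> bounds
  by half of that.\<close>

lemma prob_no_common_invariant_size_ge:
  assumes "2 ^ L \<le> N"
    and tail: "10 * (tail_ratio ^ L / (1 - tail_ratio)) \<le> 1 / 4"
    and geom: "9 ^ 4 * ((2 powr (- (1 / 15))) ^ L / (1 - 2 powr (- (1 / 15)))) \<le> (1 / 512 :: real)"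
  shows "measure_pmf.prob (indep_uniform_perms 4 N)
    {\<sigma>. (\<Inter>j\<in>{1..4}. invariant_sizes N (\<sigma> j)) = {}} \<ge> 1 / 512 / (2 ^ L) ^ 4"
proof -
  let ?p = "measure_pmf.prob (indep_uniform_perms 4 N)"
  let ?empty = "{\<sigma> :: nat \<Rightarrow> nat \<Rightarrow> nat. (\<Inter>j\<in>{1..4::nat}. invariant_sizes N (\<sigma> j)) = {}}"
  let ?F = "Pi {1..4::nat} (\<lambda>_. sparse_perms L N)"
  let ?B = "\<lambda>k. Pi {1..4::nat} (\<lambda>_. {\<sigma> \<in> sparse_perms L N. k \<in> invariant_sizes N \<sigma>})"
  let ?K = "\<lambda>i::nat. {k. 2 ^ i \<le> k \<and> k < 2 ^ (i + 1) \<and> 2 * k \<le> N}"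
  let ?q = "2 powr (- (1 / 15)) :: real"
  have finK: "finite (?K i)" for i by (rule finite_subset[of _ "{..N}"]) auto
  have cover: "?F \<subseteq> ?empty \<union> (\<Union>i\<in>{L..N}. \<Union>k\<in>?K i. ?B k)"
  proof
    fix \<sigma> assume \<sigma>: "\<sigma> \<in> ?F"
    show "\<sigma> \<in> ?empty \<union> (\<Union>i\<in>{L..N}. \<Union>k\<in>?K i. ?B k)"
    proof (cases "\<sigma> \<in> ?empty")
      case False
      then obtain k0 where k0: "\<forall>j\<in>{1..4}. k0 \<in> invariant_sizes N (\<sigma> j)" by auto
      \<comment> \<open>Passing to complements makes the common size at most \<open>N / 2\<close>,
        so that both parts are large.\<close>
      define k where "k = min k0 (N - k0)"
      have inv: "k \<in> invariant_sizes N (\<sigma> j)" if "j \<in> {1..4}" for j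
        using k0 that \<sigma> invariant_sizes_complement[of "\<sigma> j" N k0]
        by (auto simp: k_def min_def sparse_perms_def Pi_def)
      have "2 ^ L \<le> k"
        using inv[of 1] \<sigma> by (intro invariant_sizes_no_short_cycles[of "\<sigma> 1" L N]) (auto simp: sparse_perms_def Pi_def)
      have "k > 0" "k < N" using invariant_sizes_bounds[OF inv[of 1]] by auto
      then obtain i where i: "2 ^ i \<le> k" "k < 2 ^ (i + 1)" using ex_power_ivl1[of 2 k] by auto
      have "(2::nat) ^ L < 2 ^ (i + 1)" using \<open>2 ^ L \<le> k\<close> i by linarith
      then have "L \<le> i" by (simp only: power_strict_increasing_iff)
      moreover have "i \<le> N" using i \<open>k < N\<close> less_exp[of i] by linarith
      moreover have "2 * k \<le> N" by (auto simp: k_def min_def)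
      moreover have "\<sigma> \<in> ?B k" using inv \<sigma> by auto
      ultimately show ?thesis using i by auto
    qed auto
  qed
  have "(1 / 4 / 2 ^ L) ^ 4 \<le> measure_pmf.prob (uniform_perm N) (sparse_perms L N) ^ 4"
  proof (rule power_mono)
    have "1 / 4 / 2 ^ L \<le> (1 / 2 - 10 * (tail_ratio ^ L / (1 - tail_ratio))) / 2 ^ L"
      using tail by (intro divide_right_mono) auto
    also have "\<dots> \<le> measure_pmf.prob (uniform_perm N) (sparse_perms L N)"
      by (rule prob_sparse_perms_ge[OF assms(1)])
    finally show "1 / 4 / 2 ^ L \<le> measure_pmf.prob (uniform_perm N) (sparse_perms L N)" .
  qed auto
  also have "\<dots> = ?p ?F" by (rule prob_indep_uniform_perms[symmetric])
  also have "\<dots> \<le> ?p (?empty \<union> (\<Union>i\<in>{L..N}. \<Union>k\<in>?K i. ?B k))"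
    by (rule measure_pmf.finite_measure_mono[OF cover]) auto
  also have "\<dots> \<le> ?p ?empty + ?p (\<Union>i\<in>{L..N}. \<Union>k\<in>?K i. ?B k)"
    by (rule measure_Un_le) auto
  also have "?p (\<Union>i\<in>{L..N}. \<Union>k\<in>?K i. ?B k) \<le> (\<Sum>i=L..N. ?p (\<Union>k\<in>?K i. ?B k))"
    by (rule measure_UNION_le) auto
  also have "\<dots> \<le> (\<Sum>i=L..N. 9 ^ 4 / (2 ^ L) ^ 4 * ?q ^ i)"
  proof (rule sum_mono)
    fix i assume i: "i \<in> {L..N}"
    have "?p (\<Union>k\<in>?K i. ?B k) \<le> (\<Sum>k\<in>?K i. ?p (?B k))"
      by (rule measure_UNION_le) (use finK in auto)
    also have "\<dots> = (\<Sum>k\<in>?K i. measure_pmf.prob (uniform_perm N) {\<sigma> \<in> sparse_perms L N. k \<in> invariant_sizes N \<sigma>} ^ 4)"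
      by (simp only: prob_indep_uniform_perms)
    also have "\<dots> \<le> (\<Sum>k\<in>?K i. (9 / 2 ^ L * 2 powr (- (4 * real i / 15))) ^ 4)"
      by (intro sum_mono power_mono prob_sparse_invariant_size_le) (use i in auto)
    also have "\<dots> = card (?K i) * (9 / 2 ^ L * 2 powr (- (4 * real i / 15))) ^ 4" by simp
    also have "\<dots> \<le> 2 ^ i * (9 / 2 ^ L * 2 powr (- (4 * real i / 15))) ^ 4"
    proof (rule mult_right_mono)
      have "card (?K i) \<le> card {2 ^ i..<2 ^ (i + 1) :: nat}" by (intro card_mono) auto
      then have "card (?K i) \<le> 2 ^ i" by simp
      then have "real (card (?K i)) \<le> real (2 ^ i)" by (subst of_nat_le_iff)
      then show "real (card (?K i)) \<le> 2 ^ i" by simp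
    qed auto
    also have "\<dots> = 9 ^ 4 / (2 ^ L) ^ 4 * (2 ^ i * (2 powr (- (4 * real i / 15))) ^ 4)"
      by (simp add: power_mult_distrib power_divide)
    \<comment> \<open>Four factors give \<open>2 powr (- 16 i / 15)\<close>, which beats the
      \<open>2 ^ i\<close> sizes in the block by \<open>2 powr (- i / 15)\<close>.\<close>
    also have "(2::real) ^ i * (2 powr (- (4 * real i / 15))) ^ 4 = ?q ^ i"
    proof -
      have "(2 powr x) ^ 4 = 2 powr (x * 4)" for x :: real by (simp add: powr_powr[symmetric])
      then have "(2::real) ^ i * (2 powr (- (4 * real i / 15))) ^ 4
          = 2 powr (real i + - (4 * real i / 15) * 4)"
        by (simp only: powr_add powr_realpow[of 2 i, OF zero_less_numeral])
      also have "real i + - (4 * real i / 15) * 4 = - (1 / 15) * real i" by (simp add: field_simps)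
      also have "2 powr (- (1 / 15) * real i) = ?q powr real i" by (simp only: powr_powr)
      also have "\<dots> = ?q ^ i" by (rule powr_realpow) simp
      finally show ?thesis .
    qed
    finally show "?p (\<Union>k\<in>?K i. ?B k) \<le> 9 ^ 4 / (2 ^ L) ^ 4 * ?q ^ i" .
  qed
  also have "\<dots> = 9 ^ 4 / (2 ^ L) ^ 4 * (\<Sum>i=L..N. ?q ^ i)" by (simp add: sum_distrib_left)
  also have "\<dots> \<le> 9 ^ 4 / (2 ^ L) ^ 4 * (?q ^ L / (1 - ?q))"
    by (intro mult_left_mono sum_power_le_geometric) (auto simp: powr_minus_divide)
  also have "\<dots> = 9 ^ 4 * (?q ^ L / (1 - ?q)) / (2 ^ L) ^ 4" by simp
  also have "\<dots> \<le> 1 / 512 / (2 ^ L) ^ 4" by (intro divide_right_mono geom) auto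
  finally have "(1 / 4 / 2 ^ L) ^ 4 \<le> ?p ?empty + 1 / 512 / (2 ^ L) ^ 4" by linarith
  moreover have "(1 / 4 / 2 ^ L) ^ 4 = (1 / 256 / (2 ^ L) ^ 4 :: real)" by (simp add: power_divide)
  ultimately have "1 / 256 / (2 ^ L) ^ 4 - 1 / 512 / (2 ^ L) ^ 4 \<le> ?p ?empty" by linarith
  then show ?thesis by simp
qed

theorem theorem1p5:
  shows "\<exists>b\<^sub>0::real. b\<^sub>0 > 0 \<and>
    (\<forall>N::nat. N \<ge> 1 \<longrightarrow>
      measure_pmf.prob (indep_uniform_perms 4 N)
        {\<sigma>. (\<Inter>j\<in>{1..4}. invariant_sizes N (\<sigma> j)) = {}} \<ge> b\<^sub>0)"
proof -
  let ?q = "2 powr (- (1 / 15)) :: real"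
  have small: "\<forall>\<^sub>F L in sequentially. c * (x ^ L / (1 - x)) \<le> e"
    if "0 < x" "x < 1" "e > 0" for c x e :: real
  proof -
    have "(\<lambda>L. c * (x ^ L / (1 - x))) \<longlonglongrightarrow> c * (0 / (1 - x))"
      by (intro tendsto_intros LIMSEQ_power_zero) (use that in auto)
    then have "\<forall>\<^sub>F L in sequentially. c * (x ^ L / (1 - x)) < e"
      using that by (intro order_tendstoD) auto
    then show ?thesis by eventually_elim auto
  qed
  \<comment> \<open>Both conditions concern \<open>L\<close> alone, so one \<open>L\<close> serves
    every \<open>N\<close>.\<close>
  have "\<forall>\<^sub>F L in sequentially. 10 * (tail_ratio ^ L / (1 - tail_ratio)) \<le> 1 / 4 \<and>
      9 ^ 4 * (?q ^ L / (1 - ?q)) \<le> 1 / 512"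
    by (intro eventually_conj small tail_ratio) (auto simp: powr_minus_divide)
  then obtain L where L: "10 * (tail_ratio ^ L / (1 - tail_ratio)) \<le> 1 / 4"
      "9 ^ 4 * (?q ^ L / (1 - ?q)) \<le> 1 / 512"
    by (auto simp: eventually_sequentially)
  show ?thesis
  proof (intro exI[of _ "1 / 512 / (2 ^ L) ^ 4"] conjI allI impI)
    fix N :: nat assume "N \<ge> 1"
    let ?p = "measure_pmf.prob (indep_uniform_perms 4 N)"
    let ?empty = "{\<sigma>. (\<Inter>j\<in>{1..4}. invariant_sizes N (\<sigma> j)) = {}}"
    show "1 / 512 / (2 ^ L) ^ 4 \<le> ?p ?empty"
    proof (cases "2 ^ L \<le> N")
      case True
      then show ?thesis using prob_no_common_invariant_size_ge L by blast
    next
      case False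
      \<comment> \<open>For small \<open>N\<close> it is enough that none of the four permutations
        has a nontrivial invariant set, an event of probability at least
        \<open>(1 / N) ^ 4\<close>.\<close>
      then have "real N \<le> real (2 ^ L)" by (subst of_nat_le_iff) simp
      then have N: "real N \<le> 2 ^ L" by simp
      have "1 / 512 / (2 ^ L) ^ 4 \<le> (1 / 2 ^ L :: real) ^ 4" by (simp add: power_divide divide_simps)
      also have "\<dots> \<le> (1 / N) ^ 4"
        using N \<open>N \<ge> 1\<close> by (intro power_mono divide_left_mono) auto
      also have "\<dots> \<le> measure_pmf.prob (uniform_perm N) {\<sigma>. invariant_sizes N \<sigma> = {}} ^ 4"
        by (intro power_mono prob_trivial_invariant_sizes_ge \<open>N \<ge> 1\<close>) auto
      also have "\<dots> = ?p (Pi {1..4} (\<lambda>_. {\<sigma>. invariant_sizes N \<sigma> = {}}))"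
        by (rule prob_indep_uniform_perms[symmetric])
      also have "\<dots> \<le> ?p ?empty"
        by (rule measure_pmf.finite_measure_mono) (fastforce simp: Pi_iff)+
      finally show ?thesis .
    qed
  qed auto
qed

end
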